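(* Let $P\subset\mathbb{R}^d$ be a 0/1-polytope. If $P$ is simple, or if $P$ is a hyper-simplex, i.e., $P=\operatorname{conv}\{v\in\{0,1\}^d : \sum_{i=1}^d v_i=\varrho\}$ for some $\varrho\in\{0,1,\dots,d\}$, then $\mathcal{X}(\mathcal{G}(P))\geq 1$.
   Context: A 0/1-polytope is the convex hull of a nonempty set of points in $\{0,1\}^d$. A $k$-dimensional polytope is simple if every vertex lies in precisely $k$ facets, equivalently, if its graph is $k$-regular. The graph $\mathcal{G}(P)$ of a polytope $P$ has the vertices of $P$ as nodes, two of them being adjacent iff the segment joining them is a one-dimensional face of $P$. For a finite graph $H=(V,E)$ the edge expansion is $$\mathcal{X}(H)=\min\left\{\frac{|\delta(S)|}{|S|} : S\subset V,\ S\neq\emptyset,\ |S|\leq\frac{|V|}{2}\right\},$$ where $\delta(S)$ is the set of edges with one end node in $S$ and the other in $V\setminus S$. If $|V|\leq 1$ the minimum is over the empty set and is regarded as $+\infty$. *)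

theory Defs
  imports "HOL-Analysis.Analysis"
begin

definition zero_one_points :: "(real ^ 'n) set" where
  "zero_one_points = {v. \<forall>i. v $ i \<in> {0, 1}}"

definition zero_one_polytope :: "(real ^ 'n) set \<Rightarrow> bool" where
  "zero_one_polytope P \<longleftrightarrow> (\<exists>A. A \<noteq> {} \<and> A \<subseteq> zero_one_points \<and> P = convex hull A)"

(* The number of facets through a vertex is the affine dimension of the polytope.
   A facet is nonempty by definition, so a single point has no facets and is simple. *)
definition simple_polytope :: "'a::euclidean_space set \<Rightarrow> bool" where
  "simple_polytope P \<longleftrightarrow> polytope P \<and>
     (\<forall>v. v extreme_point_of P \<longrightarrow> int (card {F. F facet_of P \<and> v \<in> F}) = aff_dim P)"

definition hypersimplex :: "nat \<Rightarrow> (real ^ 'n) set" where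
  "hypersimplex r = convex hull {v \<in> zero_one_points. (\<Sum>i\<in>UNIV. v $ i) = real r}"

(* A graph is a pair (V, E) whose edges are two-element subsets of V. *)
type_synonym 'a graph = "'a set \<times> 'a set set"

definition polytope_graph :: "'a::euclidean_space set \<Rightarrow> 'a graph" where
  "polytope_graph P =
     ({v. v extreme_point_of P},
      {{u, v} | u v. u extreme_point_of P \<and> v extreme_point_of P \<and> u \<noteq> v \<and>
                     closed_segment u v edge_of P})"

definition cut_edges :: "'a graph \<Rightarrow> 'a set \<Rightarrow> 'a set set" where
  "cut_edges H S = {e \<in> snd H. \<exists>u\<in>S. \<exists>w\<in>fst H - S. e = {u, w}}"

(* For a finite graph the infimum ranges over a finite set, so it is a minimum;
   over the empty set (at most one node) it is \<infinity>. *)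
definition edge_expansion :: "'a graph \<Rightarrow> ereal" where
  "edge_expansion H =
     (INF S \<in> {S. S \<subset> fst H \<and> S \<noteq> {} \<and> real (card S) \<le> real (card (fst H)) / 2}.
        ereal (real (card (cut_edges H S)) / real (card S)))"

end

theory Submission
  imports Defs
begin

text \<open>Let the vertices of a face of a 0/1-polytope be split by a coordinate that is not constant on
  it. The two parts are again the vertex sets of faces. Suppose that every vertex in the first
  part has exactly \<open>a\<close> neighbours in the second and every vertex in the second part
  exactly \<open>b\<close> neighbours in the first, with \<open>a, b \<ge> 1\<close>. Then expansion at least
  one passes from the parts to the whole. If a set \<open>S\<close> contains at most half of each part, the
  cuts inside the parts suffice. Otherwise it contains more than half of one part and at most
  half of the other, and since the cross edges are equidistributed, the surplus of \<open>S\<close> on one side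
  forces enough cross edges into the cut. This is \<open>biregularly_splittable_cut\<close>; it reduces the
  theorem to checking biregularity of the coordinate splits for the two classes of polytopes.

  For a simple polytope of dimension \<open>k\<close>, a vertex \<open>v\<close> lies in exactly \<open>k\<close> facets, and
  leaving out one of them at a time gives exactly the edges at \<open>v\<close>. Such an edge lies in a face
  \<open>F\<close> containing \<open>v\<close> iff the omitted facet does not contain \<open>F\<close>. So \<open>v\<close> has \<open>k\<close> minus the number of
  facets containing \<open>F\<close> neighbours in \<open>F\<close> (\<open>card_neighbours_in_face\<close>), a number that does not
  depend on \<open>v\<close>. The number of neighbours in \<open>F\<close> outside a proper subface is the difference of
  two such numbers, hence constant, and it is positive because a smaller face lies in strictly more
  facets.

  For a hypersimplex, vertices are sets of fixed size, and exchanging one element for another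
  gives an edge. Fixing whether an element belongs to the set splits such a family, and the numbers
  of exchanges across the split are again constant (\<open>biregularly_splittable_slice\<close>).\<close>

section \<open>Edge expansion of biregularly splittable graphs\<close>

definition links :: "('a \<Rightarrow> 'a \<Rightarrow> bool) \<Rightarrow> 'a set \<Rightarrow> 'a set \<Rightarrow> nat" where
  "links R X Y = card {(u, w). u \<in> X \<and> w \<in> Y \<and> R u w}"

lemma finite_links:
  assumes "finite X" "finite Y"
  shows "finite {(u, w). u \<in> X \<and> w \<in> Y \<and> R u w}"
  by (rule finite_subset[of _ "X \<times> Y"]) (use assms in auto)

lemma links_Un_left:
  assumes "finite X" "finite X'" "finite Y" "X \<inter> X' = {}"
  shows "links R (X \<union> X') Y = links R X Y + links R X' Y"
proof -
  have "{(u, w). u \<in> X \<union> X' \<and> w \<in> Y \<and> R u w} =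
        {(u, w). u \<in> X \<and> w \<in> Y \<and> R u w} \<union> {(u, w). u \<in> X' \<and> w \<in> Y \<and> R u w}"
    by auto
  then show ?thesis
    unfolding links_def using assms
    by (subst card_Un_disjoint[symmetric]) (auto intro: finite_links)
qed

lemma links_commute:
  assumes "symp R"
  shows "links R X Y = links R Y X"
  unfolding links_def
  by (rule bij_betw_same_card[of prod.swap])
     (use assms in \<open>auto simp: bij_betw_def inj_on_def image_iff symp_def\<close>)

lemma links_Un_right:
  assumes "finite X" "finite Y" "finite Y'" "Y \<inter> Y' = {}"
  shows "links R X (Y \<union> Y') = links R X Y + links R X Y'"
proof -
  have "{(u, w). u \<in> X \<and> w \<in> Y \<union> Y' \<and> R u w} =
        {(u, w). u \<in> X \<and> w \<in> Y \<and> R u w} \<union> {(u, w). u \<in> X \<and> w \<in> Y' \<and> R u w}"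
    by auto
  then show ?thesis
    unfolding links_def using assms
    by (subst card_Un_disjoint[symmetric]) (auto intro: finite_links)
qed

lemma links_mono:
  assumes "finite X'" "finite Y'" "X \<subseteq> X'" "Y \<subseteq> Y'"
  shows "links R X Y \<le> links R X' Y'"
  unfolding links_def by (rule card_mono[OF finite_links[OF assms(1,2)]]) (use assms in auto)

lemma links_regular:
  assumes "finite X" "finite Y" and "\<And>u. u \<in> X \<Longrightarrow> card {w \<in> Y. R u w} = a"
  shows "links R X Y = a * card X"
proof -
  have "{(u, w). u \<in> X \<and> w \<in> Y \<and> R u w} = Sigma X (\<lambda>u. {w \<in> Y. R u w})"
    by auto
  then have "links R X Y = (\<Sum>u\<in>X. card {w \<in> Y. R u w})"
    unfolding links_def using assms by simp
  with assms show ?thesis by simp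
qed

inductive biregularly_splittable :: "('a \<Rightarrow> 'a \<Rightarrow> bool) \<Rightarrow> 'a set \<Rightarrow> bool" for R where
  point: "biregularly_splittable R {v}"
| split: "\<lbrakk>biregularly_splittable R A; biregularly_splittable R B; A \<inter> B = {};
     \<And>u. u \<in> A \<Longrightarrow> card {w \<in> B. R u w} = a; \<And>w. w \<in> B \<Longrightarrow> card {u \<in> A. R w u} = b;
     1 \<le> a; 1 \<le> b\<rbrakk> \<Longrightarrow> biregularly_splittable R (A \<union> B)"

lemma finite_biregularly_splittable: "biregularly_splittable R V \<Longrightarrow> finite V"
  by (induction rule: biregularly_splittable.induct) auto

text \<open>Here \<open>n0\<close>, \<open>n1\<close> are the sizes of the two parts and \<open>s0\<close>, \<open>s1\<close> the numbers of chosen vertices in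
  them, with at least half chosen in the second part. The cuts inside the parts contribute
  \<open>s0\<close> and \<open>n1 - s1\<close>, the cross edges at least \<open>b * s1 - a * s0\<close>. With the surplus
  \<open>x = s1 - n1 / 2\<close> and the deficit \<open>y = n0 / 2 - s0 \<ge> x\<close>, the latter equals \<open>b * x + a * y\<close> by the
  double count \<open>a * n0 = b * n1\<close>, hence is at least \<open>2 * x\<close>, which is what is missing.\<close>

lemma unbalanced_cut_bound:
  fixes a b n0 n1 s0 s1 :: real
  assumes "1 \<le> a" "1 \<le> b" "a * n0 = b * n1"
    and "2 * (s0 + s1) \<le> n0 + n1" "n1 \<le> 2 * s1"
  shows "s0 + s1 \<le> s0 + (n1 - s1) + (b * s1 - a * s0)"
proof -
  have "a * (s1 - n1 / 2) \<le> a * (n0 / 2 - s0)"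
    using assms by (intro mult_left_mono) auto
  moreover have "1 * (s1 - n1 / 2) \<le> a * (s1 - n1 / 2)" "1 * (s1 - n1 / 2) \<le> b * (s1 - n1 / 2)"
    using assms by (intro mult_right_mono; simp)+
  ultimately have "2 * (s1 - n1 / 2) \<le> a * (n0 / 2 - s0) + b * (s1 - n1 / 2)"
    by linarith
  with assms(3) show ?thesis by (simp add: algebra_simps)
qed

text \<open>All links from \<open>Y'\<close> go into \<open>X\<close>, and those that end in \<open>X'\<close> are bounded by the degrees in \<open>X'\<close>;
  the rest must leave for \<open>X - X'\<close>.\<close>

lemma links_excess:
  assumes "finite X" "finite Y" "X' \<subseteq> X" "Y' \<subseteq> Y" "symp R"
    and a: "\<And>u. u \<in> X \<Longrightarrow> card {w \<in> Y. R u w} = a"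
    and b: "\<And>w. w \<in> Y \<Longrightarrow> card {u \<in> X. R w u} = b"
  shows "b * card Y' \<le> links R Y' (X - X') + a * card X'"
proof -
  have fin: "finite X'" "finite Y'"
    using finite_subset[OF assms(3,1)] finite_subset[OF assms(4,2)] .
  have "b * card Y' = links R Y' X"
    using links_regular[OF fin(2) \<open>finite X\<close>, of R b] b assms(4) by fastforce
  also have "X = (X - X') \<union> X'" using assms by auto
  also have "links R Y' \<dots> = links R Y' (X - X') + links R Y' X'"
    using fin assms by (intro links_Un_right) auto
  also have "links R Y' X' \<le> links R Y X'"
    using fin assms by (intro links_mono) auto
  also have "\<dots> = links R X' Y" by (rule links_commute[OF \<open>symp R\<close>])
  also have "\<dots> = a * card X'" 
    using links_regular[OF fin(1) \<open>finite Y\<close>, of R a] a assms(3) by fastforce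
  finally show ?thesis by simp
qed

text \<open>The edges of the cut inside a part are bounded by the smaller of the two pieces of that part,
  since the cut is the same seen from either side; this is where symmetry of the relation enters.\<close>

lemma biregularly_splittable_cut:
  assumes "biregularly_splittable R V" "symp R" "S \<subseteq> V" "2 * card S \<le> card V"
  shows "card S \<le> links R S (V - S)"
  using assms(1,3,4)
proof (induction arbitrary: S rule: biregularly_splittable.induct)
  case (point v)
  then have "card S = 0" by simp
  then show ?case by simp
next
  case (split A B a b S)
  have finA: "finite A" and finB: "finite B"
    using split.hyps finite_biregularly_splittable by auto
  define S0 S1 where "S0 = S \<inter> A" and "S1 = S \<inter> B"
  have sub: "S0 \<subseteq> A" "S1 \<subseteq> B" "S = S0 \<union> S1" "S0 \<inter> S1 = {}"
    using split.prems split.hyps by (auto simp: S0_def S1_def)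
  have fin: "finite S0" "finite S1" "finite (A - S0)" "finite (B - S1)"
    using sub finA finB finite_subset by auto
  have rest: "A \<union> B - S = (A - S0) \<union> (B - S1)" "(A - S0) \<inter> (B - S1) = {}"
    using sub split.hyps by auto
  have cards: "card S = card S0 + card S1" "card (A \<union> B) = card A + card B"
    "card (A - S0) = card A - card S0" "card (B - S1) = card B - card S1"
    "card S0 \<le> card A" "card S1 \<le> card B"
    using sub fin finA finB split.hyps
    by (auto simp: card_Un_disjoint card_Diff_subset card_mono)
  have cut: "links R S (A \<union> B - S) =
      links R S0 (A - S0) + links R S0 (B - S1) + links R S1 (A - S0) + links R S1 (B - S1)"
    using rest sub fin by (simp add: links_Un_left links_Un_right)
  have IHA: "min (card S0) (card A - card S0) \<le> links R S0 (A - S0)"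
  proof (cases "2 * card S0 \<le> card A")
    case True
    then show ?thesis using split.IH(1)[of S0] sub by simp
  next
    case False
    have "A - (A - S0) = S0" using sub by auto
    then show ?thesis
      using split.IH(1)[of "A - S0"] False cards links_commute[OF \<open>symp R\<close>, of S0 "A - S0"] by simp
  qed
  have IHB: "min (card S1) (card B - card S1) \<le> links R S1 (B - S1)"
  proof (cases "2 * card S1 \<le> card B")
    case True
    then show ?thesis using split.IH(2)[of S1] sub by simp
  next
    case False
    have "B - (B - S1) = S1" using sub by auto
    then show ?thesis
      using split.IH(2)[of "B - S1"] False cards links_commute[OF \<open>symp R\<close>, of S1 "B - S1"] by simp
  qed
  have "links R A B = a * card A" "links R B A = b * card B"
    using split.hyps finA finB by (auto intro: links_regular)
  then have "a * card A = b * card B"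
    using links_commute[OF \<open>symp R\<close>] by metis
  then have balance: "real a * real (card A) = real b * real (card B)"
    by (metis of_nat_mult)
  have "b * card S1 \<le> links R S1 (A - S0) + a * card S0"
    using links_excess[OF finA finB sub(1,2) \<open>symp R\<close>] split.hyps by blast
  then have ex1: "real b * card S1 \<le> links R S1 (A - S0) + real a * card S0"
    by (metis of_nat_add of_nat_mult of_nat_le_iff)
  have "a * card S0 \<le> links R S0 (B - S1) + b * card S1"
    using links_excess[OF finB finA sub(2,1) \<open>symp R\<close>] split.hyps by blast
  then have ex0: "real a * card S0 \<le> links R S0 (B - S1) + real b * card S1"
    by (metis of_nat_add of_nat_mult of_nat_le_iff)
  have ab: "1 \<le> real a" "1 \<le> real b" using split.hyps by auto
  have half: "2 * (card S0 + card S1) \<le> card A + card B"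
    using split.prems cards by simp
  have half': "2 * (real (card S0) + real (card S1)) \<le> real (card A) + real (card B)"
    using of_nat_mono[OF half, where 'a = real] by simp
  from half have "\<not> (card A < 2 * card S0 \<and> card B < 2 * card S1)" by auto
  then consider "2 * card S0 \<le> card A" "2 * card S1 \<le> card B"
    | "2 * card S0 \<le> card A" "card B < 2 * card S1" | "card A < 2 * card S0" "2 * card S1 \<le> card B"
    by (metis not_le)
  then show ?case
  proof cases
    case 1
    then show ?thesis using IHA IHB cut cards by simp
  next
    case 2
    have "real (card S0) + card S1 \<le>
        card S0 + (real (card B) - card S1) + (real b * card S1 - real a * card S0)"
      using 2 by (intro unbalanced_cut_bound[OF ab balance half']) simp
    moreover have "card S0 \<le> links R S0 (A - S0)" "card B \<le> links R S1 (B - S1) + card S1"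
      using IHA IHB 2 by auto
    ultimately have "real (card S) \<le> links R S (A \<union> B - S)"
      using ex1 unfolding cut cards by linarith
    then show ?thesis by simp
  next
    case 3
    have "real (card S1) + card S0 \<le>
        card S1 + (real (card A) - card S0) + (real a * card S0 - real b * card S1)"
      using half' 3 by (intro unbalanced_cut_bound[OF ab(2,1) balance[symmetric]]) simp_all
    moreover have "card S1 \<le> links R S1 (B - S1)" "card A \<le> links R S0 (A - S0) + card S0"
      using IHA IHB 3 by auto
    ultimately have "real (card S) \<le> links R S (A \<union> B - S)"
      using ex0 unfolding cut cards by linarith
    then show ?thesis by simp
  qed
qed

text \<open>It suffices that the relation yields some of the edges of the graph, since further edges only
  enlarge cuts. The map \<open>f\<close> allows the vertices to be encoded differently from the nodes.\<close>

lemma edge_expansion_ge_one: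
  assumes V: "biregularly_splittable R V" "symp R" and "inj_on f V" "fst H = f ` V"
    and edges: "\<And>u w. \<lbrakk>u \<in> V; w \<in> V; R u w\<rbrakk> \<Longrightarrow> {f u, f w} \<in> snd H"
  shows "1 \<le> edge_expansion H"
  unfolding edge_expansion_def
proof (rule INF_greatest)
  fix S assume "S \<in> {S. S \<subset> fst H \<and> S \<noteq> {} \<and> real (card S) \<le> real (card (fst H)) / 2}"
  then have S: "S \<subset> fst H" "S \<noteq> {}" "real (card S) \<le> real (card (fst H)) / 2" by auto
  have finV: "finite V" using V finite_biregularly_splittable by auto
  define T where "T = {v \<in> V. f v \<in> S}"
  have T: "T \<subseteq> V" "S = f ` T" using S assms(4) by (auto simp: T_def)
  have injT: "inj_on f T" using T(1) assms(3) inj_on_subset by blast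
  then have "card S = card T" using T card_image by auto
  moreover have "card (fst H) = card V" using assms card_image by auto
  ultimately have "card T \<le> links R T (V - T)"
    using S by (intro biregularly_splittable_cut[OF V T(1)]) linarith
  also have "\<dots> \<le> card (cut_edges H S)"
    unfolding links_def
  proof (rule card_inj_on_le)
    have "cut_edges H S \<subseteq> Pow (fst H)" using S by (auto simp: cut_edges_def)
    then show "finite (cut_edges H S)"
      using finV assms(4) finite_subset by fastforce
    show "(\<lambda>(u, w). {f u, f w}) ` {(u, w). u \<in> T \<and> w \<in> V - T \<and> R u w} \<subseteq> cut_edges H S"
    proof clarify
      fix u w assume uw: "u \<in> T" "w \<in> V" "w \<notin> T" "R u w"
      then have "f u \<in> S" "f w \<in> fst H - S" "{f u, f w} \<in> snd H"
        using assms(4) edges T(1) by (auto simp: T_def)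
      then show "{f u, f w} \<in> cut_edges H S" unfolding cut_edges_def by blast
    qed
    show "inj_on (\<lambda>(u, w). {f u, f w}) {(u, w). u \<in> T \<and> w \<in> V - T \<and> R u w}"
    proof (rule inj_onI, clarify)
      fix u w u' w'
      assume m: "u \<in> T" "w \<in> V" "w \<notin> T" "u' \<in> T" "w' \<in> V" "w' \<notin> T" "{f u, f w} = {f u', f w'}"
      have "f u \<noteq> f w'" using m T(1) inj_onD[OF assms(3), of u w'] by auto
      then have "f u = f u'" "f w = f w'" using m by (auto simp: doubleton_eq_iff)
      then show "u = u' \<and> w = w'"
        using m T(1) inj_onD[OF assms(3)] by auto
    qed
  qed
  finally have "card S \<le> card (cut_edges H S)" using \<open>card S = card T\<close> by simp
  moreover have "finite S" using finite_imageI[of T f] finite_subset[OF T(1) finV] T(2) by simp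
  then have "0 < card S" using S by (simp add: card_gt_0_iff)
  ultimately show "1 \<le> ereal (real (card (cut_edges H S)) / real (card S))"
    by (simp add: one_ereal_def)
qed

section \<open>Edges and facets at a vertex of a simple polytope\<close>

abbreviation facets_at :: "'a::euclidean_space set \<Rightarrow> 'a \<Rightarrow> 'a set set" where
  "facets_at P v \<equiv> {F. F facet_of P \<and> v \<in> F}"

abbreviation facets_above :: "'a::euclidean_space set \<Rightarrow> 'a set \<Rightarrow> 'a set set" where
  "facets_above P F \<equiv> {G. G facet_of P \<and> F \<subseteq> G}"

lemma finite_facets_at: "polytope P \<Longrightarrow> finite (facets_at P v)"
  by (rule finite_subset[OF _ finite_polytope_facets]) auto

lemma face_eq_of_subset_aff_dim:
  fixes P :: "'a::euclidean_space set"
  assumes "polytope P" "E face_of P" "F face_of P" "E \<subseteq> F" "aff_dim F \<le> aff_dim E"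
  shows "E = F"
proof (rule ccontr)
  assume "E \<noteq> F"
  moreover have "E face_of F" using assms face_of_subset face_of_imp_subset by metis
  moreover have "convex F" using assms face_of_imp_convex by blast
  ultimately show False using face_of_aff_dim_lt[of F E] assms(5) by auto
qed

lemma face_eq_Inter_facets_above:
  fixes P :: "'a::euclidean_space set"
  assumes "polytope P" "F face_of P" "F \<noteq> {}"
  shows "F = P \<inter> \<Inter>(facets_above P F)"
proof (cases "F = P")
  case True
  have "\<not> P \<subseteq> G" if "G facet_of P" for G
    using that facet_of_imp_subset facet_of_irrefl by (metis subset_antisym)
  then show ?thesis using True by auto
next
  case False
  have "F = \<Inter>(facets_above P F)"
    using face_of_polyhedron[OF polytope_imp_polyhedron] assms False by blast
  then show ?thesis using face_of_imp_subset[OF assms(2)] by auto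
qed

text \<open>If \<open>G\<close> were the only facet containing \<open>R\<close>, then \<open>R\<close>, being the intersection of the facets
  containing it, would be \<open>G\<close>. So \<open>R\<close> lies in a second facet \<open>G'\<close>, and \<open>G \<inter> G'\<close> is a proper face
  of \<open>G\<close> that contains the facet \<open>R\<close> of \<open>G\<close>, hence equals it.\<close>

lemma ridge_in_second_facet:
  fixes P :: "'a::euclidean_space set"
  assumes P: "polytope P" and G: "G facet_of P" and R: "R facet_of G"
  obtains G' where "G' facet_of P" "G' \<noteq> G" "R = G \<inter> G'"
proof -
  have RP: "R face_of P"
    using G R face_of_trans by (auto simp: facet_of_def)
  have R': "R \<noteq> {}" "R face_of G" "aff_dim R = aff_dim P - 2" "aff_dim G = aff_dim P - 1"
    using G R by (auto simp: facet_of_def)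
  have RG: "R \<subseteq> G" using facet_of_imp_subset[OF R] .
  have "\<exists>G'. G' facet_of P \<and> R \<subseteq> G' \<and> G' \<noteq> G"
  proof (rule ccontr)
    assume "\<not> ?thesis"
    then have "facets_above P R = {G}" using G RG by blast
    then have "R = P \<inter> G" using face_eq_Inter_facets_above[OF P RP R'(1)] by auto
    then have "R = G" using facet_of_imp_subset[OF G] by auto
    with R show False by auto
  qed
  then obtain G' where G': "G' facet_of P" "R \<subseteq> G'" "G' \<noteq> G" by auto
  have GP: "G face_of P" "G' face_of P" using G G' by (auto simp: facet_of_def)
  then have int: "G \<inter> G' face_of P" by (rule face_of_Int)
  have "G \<inter> G' \<noteq> G"
  proof
    assume "G \<inter> G' = G"
    then have "G = G'"
      using G G' by (intro face_eq_of_subset_aff_dim[OF P GP]) (auto simp: facet_of_def)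
    with G' show False by auto
  qed
  moreover have "G \<inter> G' face_of G"
    using face_of_subset[OF int] facet_of_imp_subset[OF G] by auto
  moreover have "convex G" using GP face_of_imp_convex by blast
  ultimately have "aff_dim (G \<inter> G') < aff_dim G" using face_of_aff_dim_lt by blast
  then have "R = G \<inter> G'"
    using R' RG G' by (intro face_eq_of_subset_aff_dim[OF P RP int]) auto
  with G' that show thesis by blast
qed

lemma facets_at_facet_subset:
  fixes P :: "'a::euclidean_space set"
  assumes "polytope P" "G facet_of P"
  shows "facets_at G v \<subseteq> (\<lambda>H. G \<inter> H) ` (facets_at P v - {G})"
proof
  fix R assume R: "R \<in> facets_at G v"
  then obtain G' where "G' facet_of P" "G' \<noteq> G" "R = G \<inter> G'"
    using ridge_in_second_facet[OF assms] by blast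
  with R show "R \<in> (\<lambda>H. G \<inter> H) ` (facets_at P v - {G})" by blast
qed

lemma facet_at_extreme_point_exists:
  fixes P :: "'a::euclidean_space set"
  assumes "polytope P" "v extreme_point_of P" "0 < aff_dim P"
  obtains G where "G facet_of P" "v \<in> G"
proof -
  have "{v} face_of P" using assms by (simp add: face_of_singleton)
  moreover have "{v} \<noteq> P" using assms(3) by auto
  ultimately show thesis
    using face_of_polyhedron_subset_facet[OF polytope_imp_polyhedron[OF assms(1)], of "{v}"] that
    by auto
qed

lemma extreme_point_of_facet:
  assumes "v extreme_point_of P" "G facet_of P" "v \<in> G"
  shows "v extreme_point_of G"
  using assms extreme_point_of_face facet_of_imp_face_of by blast

text \<open>By induction a facet \<open>G\<close> at \<open>v\<close> has at least \<open>aff_dim P - 1\<close> facets at \<open>v\<close>. Each of them is cut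
  out of \<open>G\<close> by a facet of \<open>P\<close> other than \<open>G\<close>, and different ones by different facets.\<close>

lemma aff_dim_le_card_facets_at:
  fixes P :: "'a::euclidean_space set"
  assumes "polytope P" "v extreme_point_of P"
  shows "aff_dim P \<le> int (card (facets_at P v))"
  using assms
proof (induction "nat (aff_dim P)" arbitrary: P)
  case 0
  then show ?case by simp
next
  case (Suc m)
  then obtain G where G: "G facet_of P" "v \<in> G"
    using facet_at_extreme_point_exists by (metis zero_less_nat_eq zero_less_Suc)
  have "polytope G"
    using Suc.prems G face_of_polytope_polytope facet_of_imp_face_of by blast
  then have "aff_dim G \<le> int (card (facets_at G v))"
    using Suc.hyps(2) G extreme_point_of_facet[OF Suc.prems(2) G]
    by (intro Suc.hyps(1)) (auto simp: facet_of_def)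
  moreover have "card (facets_at G v) \<le> card (facets_at P v - {G})"
    by (rule surj_card_le[OF finite_Diff[OF finite_facets_at[OF Suc.prems(1)]]
          facets_at_facet_subset[OF Suc.prems(1) G(1)]])
  moreover have "card (facets_at P v) = Suc (card (facets_at P v - {G}))"
    using card.remove[OF finite_facets_at[OF Suc.prems(1)], of G v] G by simp
  moreover have "aff_dim G = aff_dim P - 1" using G by (simp add: facet_of_def)
  ultimately show ?case by linarith
qed

text \<open>Simplicity at \<open>v\<close> is inherited by facets: the upper bound on the number of facets of \<open>G\<close> at \<open>v\<close>
  from \<open>facets_at_facet_subset\<close> meets the lower bound \<open>aff_dim_le_card_facets_at\<close>. Equality
  throughout means that the other facets at \<open>v\<close> meet \<open>G\<close> in its facets at \<open>v\<close>, bijectively.\<close>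

lemma facets_at_facet_of_simple:
  fixes P :: "'a::euclidean_space set"
  assumes P: "polytope P" and v: "v extreme_point_of P"
    and simple: "int (card (facets_at P v)) = aff_dim P" and G: "G \<in> facets_at P v"
  shows "int (card (facets_at G v)) = aff_dim G"
    and "facets_at G v = (\<lambda>H. G \<inter> H) ` (facets_at P v - {G})"
    and "inj_on (\<lambda>H. G \<inter> H) (facets_at P v - {G})"
proof -
  let ?r = "(\<lambda>H. G \<inter> H) ` (facets_at P v - {G})"
  have Gf: "G facet_of P" "v \<in> G" using G by auto
  have "polytope G" using P Gf face_of_polytope_polytope facet_of_imp_face_of by blast
  then have ge: "aff_dim G \<le> int (card (facets_at G v))"
    using aff_dim_le_card_facets_at extreme_point_of_facet[OF v Gf] by blast
  have fin: "finite (facets_at P v - {G})" using finite_facets_at[OF P] by blast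
  have card: "card (facets_at P v) = Suc (card (facets_at P v - {G}))"
    using card.remove[OF finite_facets_at[OF P] G] .
  have dim: "aff_dim G = aff_dim P - 1" using Gf by (simp add: facet_of_def)
  have sub: "facets_at G v \<subseteq> ?r" using facets_at_facet_subset[OF P Gf(1)] .
  have le: "card (facets_at G v) \<le> card ?r" using card_mono[OF finite_imageI[OF fin] sub] .
  have le': "card ?r \<le> card (facets_at P v - {G})" using card_image_le[OF fin] .
  show "int (card (facets_at G v)) = aff_dim G"
    using ge card dim le le' simple by linarith
  show "facets_at G v = ?r"
    using sub fin ge card dim le le' simple by (intro card_subset_eq) auto
  show "inj_on (\<lambda>H. G \<inter> H) (facets_at P v - {G})"
    using fin ge card dim le le' simple by (intro eq_card_imp_inj_on) auto
qed

text \<open>By induction, passing to a facet \<open>G'\<close> other than \<open>G\<close>: the facets of \<open>G'\<close> at \<open>v\<close> are the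
  traces of the other facets, so the intersection of all but the trace of \<open>G\<close> is the same set.\<close>

lemma aff_dim_Inter_facets_at_but_one:
  fixes P :: "'a::euclidean_space set"
  assumes "polytope P" "v extreme_point_of P"
    and "int (card (facets_at P v)) = aff_dim P" "G \<in> facets_at P v"
  shows "aff_dim (P \<inter> \<Inter>(facets_at P v - {G})) = 1"
  using assms
proof (induction "card (facets_at P v)" arbitrary: P G rule: less_induct)
  case less
  have fin: "finite (facets_at P v)" using finite_facets_at[OF less.prems(1)] .
  show ?case
  proof (cases "facets_at P v = {G}")
    case True
    then show ?thesis using less.prems(3) by simp
  next
    case False
    then obtain G' where G': "G' \<in> facets_at P v" "G' \<noteq> G" using less.prems(4) by blast
    let ?r = "\<lambda>H. G' \<inter> H"
    note simple = facets_at_facet_of_simple[OF less.prems(1-3) G'(1)]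
    have f: "G' facet_of P" "v \<in> G'" using G' by auto
    have "polytope G'" using less.prems(1) f face_of_polytope_polytope facet_of_imp_face_of by blast
    moreover have "card (facets_at G' v) < card (facets_at P v)"
      using simple(1) less.prems(3) f(1) by (simp add: facet_of_def)
    moreover have "?r G \<in> facets_at G' v" using simple(2) G' less.prems(4) by blast
    ultimately have "aff_dim (G' \<inter> \<Inter>(facets_at G' v - {?r G})) = 1"
      using simple(1) extreme_point_of_facet[OF less.prems(2) f] less.hyps by blast
    also have "facets_at G' v - {?r G} = ?r ` (facets_at P v - {G'} - {G})"
      unfolding simple(2) using inj_on_image_set_diff[OF simple(3), of "facets_at P v - {G'}" "{G}"]
        G' less.prems(4) by auto
    also have "G' \<inter> \<Inter>(?r ` (facets_at P v - {G'} - {G})) = P \<inter> \<Inter>(facets_at P v - {G})"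
      using f facet_of_imp_subset[OF f(1)] G' by auto
    finally show ?thesis .
  qed
qed

context
  fixes P :: "'a::euclidean_space set" and v :: 'a
  assumes P: "polytope P" and v: "v extreme_point_of P"
    and simple: "int (card (facets_at P v)) = aff_dim P"
begin

lemma Inter_facets_at: "P \<inter> \<Inter>(facets_at P v) = {v}"
  using face_eq_Inter_facets_above[OF P, of "{v}"] v by (simp add: face_of_singleton)

lemma edge_omitting_facet:
  assumes "G \<in> facets_at P v"
  shows "(P \<inter> \<Inter>(facets_at P v - {G})) edge_of P"
proof -
  have "(P \<inter> \<Inter>(facets_at P v - {G})) face_of P"
  proof -
    have "\<Inter>(insert P (facets_at P v - {G})) face_of P"
      using polytope_imp_convex[OF P]
      by (intro face_of_Inter) (auto simp: face_of_refl facet_of_imp_face_of)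
    then show ?thesis by simp
  qed
  then show ?thesis
    using aff_dim_Inter_facets_at_but_one[OF P v simple assms] by (simp add: edge_of_def)
qed

text \<open>A face \<open>F\<close> at \<open>v\<close> that is not contained in \<open>G\<close> is cut out of \<open>P\<close> by facets at \<open>v\<close> other than \<open>G\<close>,
  and so contains the edge that omits \<open>G\<close>. If \<open>F\<close> is contained in \<open>G\<close>, an edge inside \<open>F\<close> that omits
  \<open>G\<close> would lie in all facets at \<open>v\<close>, which meet only in \<open>v\<close>.\<close>

lemma edge_omitting_facet_subset_iff:
  assumes G: "G \<in> facets_at P v" and F: "F face_of P" "v \<in> F"
  shows "P \<inter> \<Inter>(facets_at P v - {G}) \<subseteq> F \<longleftrightarrow> \<not> F \<subseteq> G"
proof
  assume sub: "P \<inter> \<Inter>(facets_at P v - {G}) \<subseteq> F"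
  show "\<not> F \<subseteq> G"
  proof
    assume "F \<subseteq> G"
    then have "P \<inter> \<Inter>(facets_at P v - {G}) \<subseteq> P \<inter> \<Inter>(facets_at P v)" using sub by auto
    then have "P \<inter> \<Inter>(facets_at P v - {G}) \<subseteq> {v}" using Inter_facets_at by simp
    from aff_dim_subset[OF this] show False
      using aff_dim_Inter_facets_at_but_one[OF P v simple G] by simp
  qed
next
  assume "\<not> F \<subseteq> G"
  then have "facets_above P F \<subseteq> facets_at P v - {G}" using F by auto
  then have "P \<inter> \<Inter>(facets_at P v - {G}) \<subseteq> P \<inter> \<Inter>(facets_above P F)" by blast
  also have "\<dots> = F" using face_eq_Inter_facets_above[OF P F(1)] F(2) by auto
  finally show "P \<inter> \<Inter>(facets_at P v - {G}) \<subseteq> F" .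
qed

text \<open>Sending a facet \<open>G\<close> at \<open>v\<close> to the intersection of the others is a bijection from the facets at
  \<open>v\<close> not containing \<open>F\<close> to the edges at \<open>v\<close> inside \<open>F\<close>. It is onto because an edge at \<open>v\<close> is not
  contained in all facets at \<open>v\<close>; for any facet \<open>G\<close> that does not contain it, it contains the edge
  omitting \<open>G\<close> and so equals it.\<close>

lemma card_edges_at_in_face:
  assumes F: "F face_of P" "v \<in> F"
  shows "card {e. e edge_of P \<and> v \<in> e \<and> e \<subseteq> F} + card (facets_above P F) = card (facets_at P v)"
proof -
  let ?e = "\<lambda>G. P \<inter> \<Inter>(facets_at P v - {G})"
  have sub: "facets_above P F \<subseteq> facets_at P v" using F by auto
  have fin: "finite (facets_at P v)" using finite_facets_at[OF P] .
  have "bij_betw ?e (facets_at P v - facets_above P F) {e. e edge_of P \<and> v \<in> e \<and> e \<subseteq> F}"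
    unfolding bij_betw_def
  proof
    show "inj_on ?e (facets_at P v - facets_above P F)"
    proof (rule inj_onI, rule ccontr)
      fix G H
      assume GH: "G \<in> facets_at P v - facets_above P F" "H \<in> facets_at P v - facets_above P F"
        "?e G = ?e H" "G \<noteq> H"
      then have "H \<in> facets_at P v" "H face_of P" "v \<in> H" "?e H \<subseteq> H"
        using facet_of_imp_face_of by blast+
      then show False using edge_omitting_facet_subset_iff[of H H] by blast
    qed
    show "?e ` (facets_at P v - facets_above P F) = {e. e edge_of P \<and> v \<in> e \<and> e \<subseteq> F}"
    proof (intro equalityI subsetI)
      fix e assume "e \<in> ?e ` (facets_at P v - facets_above P F)"
      then obtain G where G: "G \<in> facets_at P v" "\<not> F \<subseteq> G" "e = ?e G" by auto
      then have "e edge_of P" "e \<subseteq> F"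
        using edge_omitting_facet edge_omitting_facet_subset_iff[OF G(1) F] by auto
      moreover have "v \<in> e" using Inter_facets_at G by blast
      ultimately show "e \<in> {e. e edge_of P \<and> v \<in> e \<and> e \<subseteq> F}" by auto
    next
      fix e assume "e \<in> {e. e edge_of P \<and> v \<in> e \<and> e \<subseteq> F}"
      then have e: "e face_of P" "aff_dim e = 1" "v \<in> e" "e \<subseteq> F" by (auto simp: edge_of_def)
      have "facets_above P e \<noteq> facets_at P v"
      proof
        assume "facets_above P e = facets_at P v"
        then have "e = {v}"
          using face_eq_Inter_facets_above[OF P e(1)] e(3) Inter_facets_at by auto
        with e(2) show False by simp
      qed
      then obtain G where G: "G \<in> facets_at P v" "\<not> e \<subseteq> G" using e(3) by blast
      have "?e G \<subseteq> e" using edge_omitting_facet_subset_iff[OF G(1) e(1,3)] G(2) by blast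
      then have "?e G = e"
        using edge_omitting_facet[OF G(1)] e
        by (intro face_eq_of_subset_aff_dim[OF P]) (auto simp: edge_of_def)
      then show "e \<in> ?e ` (facets_at P v - facets_above P F)" using G e(4) by blast
    qed
  qed
  from bij_betw_same_card[OF this]
  have "card {e. e edge_of P \<and> v \<in> e \<and> e \<subseteq> F} = card (facets_at P v - facets_above P F)" ..
  also have "\<dots> = card (facets_at P v) - card (facets_above P F)"
    by (rule card_Diff_subset[OF finite_subset[OF sub fin] sub])
  finally show ?thesis using card_mono[OF fin sub] by simp
qed

end

definition graph_adjacent :: "'a::euclidean_space set \<Rightarrow> 'a \<Rightarrow> 'a \<Rightarrow> bool" where
  "graph_adjacent P u w \<longleftrightarrow> u \<noteq> w \<and> closed_segment u w edge_of P"

lemma symp_graph_adjacent: "symp (graph_adjacent P)"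
  by (auto simp: symp_def graph_adjacent_def closed_segment_commute)

lemma edge_at_extreme_point:
  fixes P :: "'a::euclidean_space set"
  assumes P: "polytope P" and "v extreme_point_of P" "e edge_of P" "v \<in> e"
  obtains w where "w extreme_point_of P" "w \<noteq> v" "e = closed_segment v w"
proof -
  have e: "e face_of P" "aff_dim e = 1" using assms by (auto simp: edge_of_def)
  have poly: "polytope e" using face_of_polytope_polytope[OF P e(1)] .
  then obtain a b where ab: "e = closed_segment a b"
    using compact_convex_collinear_segment[of e] assms(4) e(2)
    by (metis collinear_aff_dim empty_iff order_refl polytope_imp_compact polytope_imp_convex)
  have ext: "x extreme_point_of P" if "x = a \<or> x = b" for x
    using that ab extreme_point_of_segment extreme_point_of_face[OF e(1)] by blast
  have "v extreme_point_of e" using assms extreme_point_of_face[OF e(1)] by blast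
  then have "v = a \<or> v = b" using ab extreme_point_of_segment by metis
  moreover have "a \<noteq> b" using e(2) ab by auto
  ultimately show thesis
    using that[of a] that[of b] ext ab closed_segment_commute by metis
qed

text \<open>The number of facets containing \<open>F\<close> is the same for all vertices of \<open>F\<close>, so in a simple polytope
  the graph of every face is regular.\<close>

lemma card_neighbours_in_face:
  fixes P :: "'a::euclidean_space set"
  assumes P: "polytope P" and v: "v extreme_point_of P"
    and simple: "int (card (facets_at P v)) = aff_dim P"
    and F: "F face_of P" "v \<in> F"
  shows "card {w. w extreme_point_of F \<and> graph_adjacent P v w} + card (facets_above P F)
         = card (facets_at P v)"
proof -
  have "bij_betw (closed_segment v) {w. w extreme_point_of F \<and> graph_adjacent P v w}
          {e. e edge_of P \<and> v \<in> e \<and> e \<subseteq> F}"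
    unfolding bij_betw_def
  proof (intro conjI equalityI subsetI)
    show "inj_on (closed_segment v) {w. w extreme_point_of F \<and> graph_adjacent P v w}"
      by (rule inj_onI) (metis (mono_tags, lifting) extreme_point_of_segment graph_adjacent_def mem_Collect_eq)
  next
    fix e assume "e \<in> closed_segment v ` {w. w extreme_point_of F \<and> graph_adjacent P v w}"
    then obtain w where w: "w extreme_point_of F" "graph_adjacent P v w" "e = closed_segment v w"
      by auto
    then have "w \<in> F" by (simp add: extreme_point_of_def)
    then have "e \<subseteq> F" using w F face_of_imp_convex[OF F(1)] closed_segment_subset by metis
    then show "e \<in> {e. e edge_of P \<and> v \<in> e \<and> e \<subseteq> F}"
      using w by (auto simp: graph_adjacent_def)
  next
    fix e assume "e \<in> {e. e edge_of P \<and> v \<in> e \<and> e \<subseteq> F}"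
    then have e: "e edge_of P" "v \<in> e" "e \<subseteq> F" by auto
    obtain w where w: "w extreme_point_of P" "w \<noteq> v" "e = closed_segment v w"
      using edge_at_extreme_point[OF P v e(1,2)] .
    then have "w \<in> F" using e(3) by auto
    then have "w extreme_point_of F" using w(1) extreme_point_of_face[OF F(1)] by blast
    then show "e \<in> closed_segment v ` {w. w extreme_point_of F \<and> graph_adjacent P v w}"
      using w e(1) by (auto simp: graph_adjacent_def)
  qed
  from bij_betw_same_card[OF this] show ?thesis
    using card_edges_at_in_face[OF P v simple F] by simp
qed

lemma facets_above_psubset:
  fixes P :: "'a::euclidean_space set"
  assumes P: "polytope P" and F: "F face_of P" and E: "E face_of P" "E \<noteq> {}" "E \<subset> F"
  shows "card (facets_above P F) < card (facets_above P E)"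
proof (rule psubset_card_mono)
  show "finite (facets_above P E)"
    by (rule finite_subset[OF _ finite_polytope_facets[OF P]]) auto
  have "facets_above P F \<noteq> facets_above P E"
    using face_eq_Inter_facets_above[OF P] F E by (metis psubset_imp_subset psubset_eq subset_empty)
  then show "facets_above P F \<subset> facets_above P E" using E(3) by auto
qed

section \<open>Coordinate splits of simple 0/1-polytopes\<close>

lemma zero_one_polytope_coordinate_bounds:
  fixes x :: "real ^ 'n"
  assumes "A \<subseteq> zero_one_points" "x \<in> convex hull A"
  shows "0 \<le> x $ i" "x $ i \<le> 1"
proof -
  have "0 \<le> v $ i \<and> v $ i \<le> 1" if "v \<in> A" for v
  proof -
    have "v $ i \<in> {0, 1}" using that assms(1) by (auto simp: zero_one_points_def)
    then show ?thesis by auto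
  qed
  then have "A \<subseteq> {x. axis i 1 \<bullet> x \<ge> 0} \<inter> {x. axis i 1 \<bullet> x \<le> 1}"
    by (auto simp: inner_axis')
  then have "convex hull A \<subseteq> {x. axis i 1 \<bullet> x \<ge> 0} \<inter> {x. axis i 1 \<bullet> x \<le> 1}"
    by (intro hull_minimal convex_Int convex_halfspace_le convex_halfspace_ge)
  then show "0 \<le> x $ i" "x $ i \<le> 1" using assms(2) by (auto simp: inner_axis')
qed

text \<open>The inequalities \<open>0 \<le> x $ i\<close> and \<open>x $ i \<le> 1\<close> hold throughout a 0/1-polytope, so their
  hyperplanes are supporting.\<close>

lemma coordinate_faces:
  fixes A :: "(real ^ 'n) set"
  assumes A: "A \<subseteq> zero_one_points" and F: "F face_of convex hull A"
  shows "F \<inter> {x. x $ i = 0} face_of convex hull A" "F \<inter> {x. x $ i = 1} face_of convex hull A"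
proof -
  have F': "x \<in> F \<Longrightarrow> 0 \<le> x $ i \<and> x $ i \<le> 1" for x
    using zero_one_polytope_coordinate_bounds[OF A] face_of_imp_subset[OF F] by blast
  have "F \<inter> {x. axis i 1 \<bullet> x = 0} face_of F" "F \<inter> {x. axis i 1 \<bullet> x = 1} face_of F"
    using F' face_of_imp_convex[OF F]
    by (intro face_of_Int_supporting_hyperplane_ge face_of_Int_supporting_hyperplane_le;
        simp add: inner_axis')+
  then show "F \<inter> {x. x $ i = 0} face_of convex hull A" "F \<inter> {x. x $ i = 1} face_of convex hull A"
    using F face_of_trans by (auto simp: inner_axis')
qed

text \<open>A coordinate in which two vertices of \<open>F\<close> differ splits the vertices of \<open>F\<close> into those of two
  proper faces \<open>F0\<close> and \<open>F1\<close>. A vertex of \<open>F0\<close> has as many neighbours in \<open>F1\<close> as in \<open>F\<close> but not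
  in \<open>F0\<close>, which is the difference of the numbers of facets of \<open>P\<close> containing \<open>F0\<close> and \<open>F\<close>.\<close>

lemma biregularly_splittable_simple_face:
  fixes P :: "(real ^ 'n) set"
  assumes P: "zero_one_polytope P" "simple_polytope P" and F: "F face_of P" "F \<noteq> {}"
  shows "biregularly_splittable (graph_adjacent P) {v. v extreme_point_of F}"
  using F
proof (induction "card {v. v extreme_point_of F}" arbitrary: F rule: less_induct)
  case less
  obtain A where A: "A \<subseteq> zero_one_points" "P = convex hull A"
    using P(1) by (auto simp: zero_one_polytope_def)
  have poly: "polytope P" using P(2) by (simp add: simple_polytope_def)
  have simple: "int (card (facets_at P v)) = aff_dim P" if "v extreme_point_of P" for v
    using P(2) that by (simp add: simple_polytope_def)
  have polyF: "polytope F" using face_of_polytope_polytope[OF poly less.prems(1)] .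
  have fin: "finite {v. v extreme_point_of F}"
    using finite_polyhedron_extreme_points polytope_imp_polyhedron polyF by blast
  obtain v where v: "v extreme_point_of F"
    using extreme_point_exists_convex less.prems(2) polyF polytope_imp_compact polytope_imp_convex
    by blast
  have ext: "x extreme_point_of E \<longleftrightarrow> x extreme_point_of P \<and> x \<in> E" if "E face_of P" for x E
    using extreme_point_of_face[OF that] .
  show ?case
  proof (cases "{v. v extreme_point_of F} = {v}")
    case True
    then show ?thesis by (simp add: biregularly_splittable.point)
  next
    case False
    then obtain w where w: "w extreme_point_of F" "w \<noteq> v" using v by auto
    have zo: "x $ i = 0 \<or> x $ i = 1" if "x extreme_point_of F" for x i
      using that ext[OF less.prems(1)] A extreme_point_of_convex_hull
      by (fastforce simp: zero_one_points_def)
    obtain i where i: "v $ i \<noteq> w $ i" using w(2) by (metis vec_eq_iff)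
    define F0 F1 where "F0 = F \<inter> {x. x $ i = 0}" and "F1 = F \<inter> {x. x $ i = 1}"
    have face: "F0 face_of P" "F1 face_of P"
      using coordinate_faces[OF A(1)] less.prems(1) A(2) by (auto simp: F0_def F1_def)
    have vwF: "v \<in> F" "w \<in> F" using v w(1) by (auto simp: extreme_point_of_def)
    have vw: "v \<in> F0 \<and> w \<in> F1 \<or> w \<in> F0 \<and> v \<in> F1"
      using i zo[OF v, of i] zo[OF w(1), of i] vwF by (auto simp: F0_def F1_def)
    then have proper: "F0 \<noteq> {}" "F1 \<noteq> {}" "F0 \<inter> F1 = {}"
      by (auto simp: F0_def F1_def)
    moreover have "F0 \<subseteq> F" "F1 \<subseteq> F" by (auto simp: F0_def F1_def)
    ultimately have sub: "F0 \<subset> F" "F1 \<subset> F" by blast+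
    let ?V = "\<lambda>E. {v. v extreme_point_of E}"
    have V: "?V F = ?V F0 \<union> ?V F1" "?V F0 \<inter> ?V F1 = {}"
      using zo[of _ i] ext[OF face(1)] ext[OF face(2)] ext[OF less.prems(1)] proper
      by (auto simp: F0_def F1_def)
    have Vne: "?V F0 \<noteq> {}" "?V F1 \<noteq> {}"
      using vw v w(1) ext[OF face(1)] ext[OF face(2)] ext[OF less.prems(1)] by blast+
    have finV: "finite (?V F0)" "finite (?V F1)" using V fin by (metis finite_Un)+
    have "card (?V F0) < card (?V F)" "card (?V F1) < card (?V F)"
      using V Vne finV fin by (auto intro!: psubset_card_mono)
    then have IH: "biregularly_splittable (graph_adjacent P) (?V F0)"
      "biregularly_splittable (graph_adjacent P) (?V F1)"
      using less.hyps face proper by blast+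
    have cross: "card {y \<in> ?V F''. graph_adjacent P x y} =
        card (facets_above P F') - card (facets_above P F)"
      if "x \<in> ?V F'" and F': "F' = F0 \<and> F'' = F1 \<or> F' = F1 \<and> F'' = F0" for x F' F''
    proof -
      have F'face: "F' face_of P" using F' face by blast
      then have x: "x extreme_point_of P" "x \<in> F'" "x \<in> F"
        using that(1) ext F' sub by auto
      have "?V F = ?V F' \<union> ?V F''" "?V F' \<inter> ?V F'' = {}" "finite (?V F')" "finite (?V F'')"
        using F' V finV by auto
      then have "card {y. y extreme_point_of F \<and> graph_adjacent P x y} =
          card {y. y extreme_point_of F' \<and> graph_adjacent P x y} + card {y \<in> ?V F''. graph_adjacent P x y}"
        by (subst card_Un_disjoint[symmetric]) (auto intro!: arg_cong[of _ _ card])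
      then show ?thesis
        using card_neighbours_in_face[OF poly x(1) simple[OF x(1)] F'face x(2)]
          card_neighbours_in_face[OF poly x(1) simple[OF x(1)] less.prems(1) x(3)]
        by linarith
    qed
    show ?thesis unfolding V(1)
    proof (rule biregularly_splittable.split[OF IH V(2)])
      show "card {y \<in> ?V F1. graph_adjacent P x y} =
          card (facets_above P F0) - card (facets_above P F)" if "x \<in> ?V F0" for x
        using cross that by blast
      show "card {y \<in> ?V F0. graph_adjacent P x y} =
          card (facets_above P F1) - card (facets_above P F)" if "x \<in> ?V F1" for x
        using cross that by blast
    qed (use facets_above_psubset[OF poly less.prems(1)] face proper sub in
          \<open>simp_all add: Suc_leI\<close>)
  qed
qed

section \<open>Families of sets of equal size\<close>

text \<open>These sets encode the vertices of the faces of a hypersimplex on which the coordinates in \<open>L\<close> are one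
  and those outside \<open>U\<close> are zero.\<close>

definition slice :: "'a set \<Rightarrow> 'a set \<Rightarrow> nat \<Rightarrow> 'a set set" where
  "slice L U r = {X. L \<subseteq> X \<and> X \<subseteq> U \<and> card X = r}"

definition swap_adjacent :: "'a set \<Rightarrow> 'a set \<Rightarrow> bool" where
  "swap_adjacent X Y \<longleftrightarrow> (\<exists>i j. X - Y = {i} \<and> Y - X = {j})"

lemma symp_swap_adjacent: "symp swap_adjacent"
  by (auto simp: symp_def swap_adjacent_def)

text \<open>Such a neighbour arises from \<open>X\<close> by inserting \<open>i\<close> and removing an element outside \<open>L\<close>.\<close>

lemma card_swap_neighbours_up:
  assumes "finite U" "X \<in> slice L (U - {i}) r" "i \<in> U" "i \<notin> L"
  shows "card {Y \<in> slice (insert i L) U r. swap_adjacent X Y} = r - card L"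
proof -
  have X: "L \<subseteq> X" "X \<subseteq> U" "i \<notin> X" "card X = r" "finite X"
    using assms finite_subset[of X U] by (auto simp: slice_def)
  have "{Y \<in> slice (insert i L) U r. swap_adjacent X Y} = (\<lambda>j. insert i (X - {j})) ` (X - L)"
  proof (intro equalityI subsetI)
    fix Y assume "Y \<in> {Y \<in> slice (insert i L) U r. swap_adjacent X Y}"
    then obtain j k where Y: "insert i L \<subseteq> Y" "X - Y = {j}" "Y - X = {k}"
      by (auto simp: slice_def swap_adjacent_def)
    then have "k = i" using X(3) by auto
    then have "Y = insert i (X - {j})" "j \<in> X - L" using Y by auto
    then show "Y \<in> (\<lambda>j. insert i (X - {j})) ` (X - L)" by blast
  next
    fix Y assume "Y \<in> (\<lambda>j. insert i (X - {j})) ` (X - L)"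
    then obtain j where j: "j \<in> X" "j \<notin> L" "Y = insert i (X - {j})" by auto
    then have "card Y = Suc (card (X - {j}))" using X by simp
    then have "card Y = r" using card.remove[OF X(5) j(1)] X(4) by simp
    moreover have "X - Y = {j}" "Y - X = {i}" using j X(3) by auto
    then have "swap_adjacent X Y" unfolding swap_adjacent_def by blast
    ultimately show "Y \<in> {Y \<in> slice (insert i L) U r. swap_adjacent X Y}"
      using j X assms(3) by (auto simp: slice_def)
  qed
  moreover have "inj_on (\<lambda>j. insert i (X - {j})) (X - L)"
  proof (rule inj_onI)
    fix j k
    assume jk: "j \<in> X - L" "k \<in> X - L" "insert i (X - {j}) = insert i (X - {k})"
    have "j \<notin> insert i (X - {j})" using jk(1) X(3) by auto
    then have "j \<notin> insert i (X - {k})" using jk(3) by simp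
    then show "j = k" using jk(1) by auto
  qed
  ultimately have "card {Y \<in> slice (insert i L) U r. swap_adjacent X Y} = card (X - L)"
    by (simp add: card_image)
  then show ?thesis using card_Diff_subset[OF finite_subset[OF X(1,5)] X(1)] X(4) by simp
qed

text \<open>Such a neighbour arises from \<open>Y\<close> by removing \<open>i\<close> and inserting an element of \<open>U\<close>.\<close>

lemma card_swap_neighbours_down:
  assumes "finite U" "Y \<in> slice (insert i L) U r" "i \<in> U" "i \<notin> L"
  shows "card {X \<in> slice L (U - {i}) r. swap_adjacent Y X} = card U - r"
proof -
  have Y: "L \<subseteq> Y" "Y \<subseteq> U" "i \<in> Y" "card Y = r" "finite Y"
    using assms finite_subset[of Y U] by (auto simp: slice_def)
  have "{X \<in> slice L (U - {i}) r. swap_adjacent Y X} = (\<lambda>j. insert j (Y - {i})) ` (U - Y)"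
  proof (intro equalityI subsetI)
    fix X assume "X \<in> {X \<in> slice L (U - {i}) r. swap_adjacent Y X}"
    then obtain j k where X: "X \<subseteq> U - {i}" "Y - X = {k}" "X - Y = {j}"
      by (auto simp: slice_def swap_adjacent_def)
    then have "k = i" using Y(3) by auto
    then have "X = insert j (Y - {i})" "j \<in> U - Y" using X by auto
    then show "X \<in> (\<lambda>j. insert j (Y - {i})) ` (U - Y)" by blast
  next
    fix X assume "X \<in> (\<lambda>j. insert j (Y - {i})) ` (U - Y)"
    then obtain j where j: "j \<in> U" "j \<notin> Y" "X = insert j (Y - {i})" by auto
    then have "card X = Suc (card (Y - {i}))" using Y by simp
    then have "card X = r" using card.remove[OF Y(5,3)] Y(4) by simp
    moreover have "X - Y = {j}" "Y - X = {i}" using j Y(3) by auto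
    then have "swap_adjacent Y X" unfolding swap_adjacent_def by blast
    ultimately show "X \<in> {X \<in> slice L (U - {i}) r. swap_adjacent Y X}"
      using j Y assms(4) by (auto simp: slice_def)
  qed
  moreover have "inj_on (\<lambda>j. insert j (Y - {i})) (U - Y)"
    by (intro inj_onI) blast
  ultimately have "card {X \<in> slice L (U - {i}) r. swap_adjacent Y X} = card (U - Y)"
    by (simp add: card_image)
  then show ?thesis using card_Diff_subset[OF Y(5,2)] Y(4) by simp
qed

text \<open>Two different members of a slice have the same size, so some \<open>i\<close> belongs to one and not to the
  other. Splitting by membership of \<open>i\<close> gives two nonempty slices with a smaller range \<open>U - L\<close>.\<close>

lemma biregularly_splittable_slice:
  assumes "finite U" "slice L U r \<noteq> {}"
  shows "biregularly_splittable swap_adjacent (slice L U r)"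
  using assms
proof (induction "card (U - L)" arbitrary: L U rule: less_induct)
  case less
  then obtain X where X: "X \<in> slice L U r" by auto
  show ?case
  proof (cases "slice L U r = {X}")
    case True
    then show ?thesis by (simp add: biregularly_splittable.point)
  next
    case False
    then obtain Y where Y: "Y \<in> slice L U r" "Y \<noteq> X" using X by blast
    have "finite Y" using Y less.prems(1) finite_subset[of Y U] by (auto simp: slice_def)
    then have "\<not> X \<subseteq> Y" using X Y card_subset_eq[of Y X] by (auto simp: slice_def)
    then obtain i where i: "i \<in> X" "i \<notin> Y" by auto
    then have iUL: "i \<in> U" "i \<notin> L" using X Y by (auto simp: slice_def)
    let ?A = "slice L (U - {i}) r" and ?B = "slice (insert i L) U r"
    have mem: "Y \<in> ?A" "X \<in> ?B" using X Y i by (auto simp: slice_def)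
    have "U - {i} - L = U - L - {i}" "U - insert i L = U - L - {i}" by auto
    moreover have "card (U - L - {i}) < card (U - L)"
      using less.prems(1) iUL by (intro psubset_card_mono) auto
    ultimately have IH: "biregularly_splittable swap_adjacent ?A" "biregularly_splittable swap_adjacent ?B"
      using less.hyps less.prems(1) mem by (metis empty_iff finite_Diff)+
    have "finite X" using X less.prems(1) finite_subset[of X U] by (auto simp: slice_def)
    then have "card (insert i L) \<le> card X"
      using mem(2) by (intro card_mono) (auto simp: slice_def)
    moreover have "card Y \<le> card (U - {i})"
      using mem(1) less.prems(1) by (intro card_mono) (auto simp: slice_def)
    moreover have "finite L" using X less.prems(1) finite_subset[of L U] by (auto simp: slice_def)
    moreover have "card X = r" "card Y = r" using X Y by (simp_all add: slice_def)
    ultimately have pos: "1 \<le> r - card L" "1 \<le> card U - r"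
      using iUL(2) card.remove[OF less.prems(1) iUL(1)] by simp_all
    have "biregularly_splittable swap_adjacent (?A \<union> ?B)"
      using IH
    proof (rule biregularly_splittable.split)
      show "?A \<inter> ?B = {}" by (auto simp: slice_def)
      show "card {Y' \<in> ?B. swap_adjacent X' Y'} = r - card L" if "X' \<in> ?A" for X'
        using card_swap_neighbours_up[OF less.prems(1) that iUL] .
      show "card {X' \<in> ?A. swap_adjacent Y' X'} = card U - r" if "Y' \<in> ?B" for Y'
        using card_swap_neighbours_down[OF less.prems(1) that iUL] .
    qed (rule pos)+
    also have "?A \<union> ?B = slice L U r" using iUL by (auto simp: slice_def)
    finally show ?thesis .
  qed
qed

section \<open>Edges of hypersimplices\<close>

definition cube_vertex :: "'n set \<Rightarrow> real ^ 'n" where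
  "cube_vertex X = (\<chi> i. if i \<in> X then 1 else 0)"

lemma cube_vertex_nth [simp]: "cube_vertex X $ i = (if i \<in> X then 1 else 0)"
  by (simp add: cube_vertex_def)

lemma inj_cube_vertex: "inj cube_vertex"
  by (rule injI) (auto simp: vec_eq_iff split: if_splits)

lemma layer_eq_cube_vertex_slice:
  "{v \<in> zero_one_points. (\<Sum>i\<in>UNIV. v $ i) = real r} =
   (cube_vertex ` slice {} UNIV r :: (real ^ 'n) set)"
proof (intro equalityI subsetI)
  fix v :: "real ^ 'n"
  assume v: "v \<in> {v \<in> zero_one_points. (\<Sum>i\<in>UNIV. v $ i) = real r}"
  let ?X = "{i. v $ i = 1}"
  have "v = cube_vertex ?X" using v by (auto simp: vec_eq_iff zero_one_points_def)
  moreover have "(\<Sum>i\<in>UNIV. cube_vertex ?X $ i) = real (card ?X)" by (simp add: sum.If_cases)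
  ultimately have "card ?X = r" using v by simp
  then show "v \<in> cube_vertex ` slice {} UNIV r"
    using \<open>v = cube_vertex ?X\<close> by (auto simp: slice_def)
qed (auto simp: slice_def zero_one_points_def sum.If_cases)

text \<open>A point strictly between \<open>a\<close> and \<open>b\<close> whose \<open>i\<close>-th coordinate attains the bound zero or one forces
  both \<open>a\<close> and \<open>b\<close> to attain it.\<close>

lemma zero_one_point_extreme:
  fixes A :: "(real ^ 'n) set"
  assumes A: "A \<subseteq> zero_one_points" and "x \<in> A"
  shows "x extreme_point_of convex hull A"
  unfolding extreme_point_of_def
proof (intro conjI ballI notI)
  show "x \<in> convex hull A" using assms(2) by (rule hull_inc)
  fix a b assume ab: "a \<in> convex hull A" "b \<in> convex hull A" "x \<in> open_segment a b"
  then obtain u where u: "0 < u" "u < 1" "x = (1 - u) *\<^sub>R a + u *\<^sub>R b"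
    by (auto simp: in_segment)
  have "a $ i = b $ i" for i
  proof -
    have bounds: "0 \<le> a $ i" "a $ i \<le> 1" "0 \<le> b $ i" "b $ i \<le> 1"
      using zero_one_polytope_coordinate_bounds[OF A] ab by auto
    have xi: "x $ i = (1 - u) * a $ i + u * b $ i" using u by simp
    have "x $ i = 0 \<or> x $ i = 1" using assms by (auto simp: zero_one_points_def)
    then show ?thesis
    proof
      assume "x $ i = 0"
      then have "(1 - u) * a $ i = 0" "u * b $ i = 0"
        using xi bounds u add_nonneg_eq_0_iff[of "(1 - u) * a $ i" "u * b $ i"] by auto
      then show ?thesis using u by simp
    next
      assume "x $ i = 1"
      then have "(1 - u) * (1 - a $ i) + u * (1 - b $ i) = 0"
        using xi by (simp add: algebra_simps)
      then have "(1 - u) * (1 - a $ i) = 0" "u * (1 - b $ i) = 0"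
        using bounds u add_nonneg_eq_0_iff[of "(1 - u) * (1 - a $ i)" "u * (1 - b $ i)"] by auto
      then show ?thesis using u by simp
    qed
  qed
  then have "a = b" by (simp add: vec_eq_iff)
  with ab(3) show False by simp
qed

text \<open>Fixing the coordinates in which the two vertices agree defines a face. The only sets of size \<open>r\<close>
  between \<open>X \<inter> Y\<close> and \<open>X \<union> Y\<close> are \<open>X\<close> and \<open>Y\<close>, so this face is the segment joining them.\<close>

lemma hypersimplex_swap_edge:
  fixes X Y :: "'n::finite set"
  assumes X: "X \<in> slice {} UNIV r" and Y: "Y \<in> slice {} UNIV r" and adj: "swap_adjacent X Y"
  shows "closed_segment (cube_vertex X) (cube_vertex Y) edge_of (hypersimplex r :: (real ^ 'n) set)"
proof -
  let ?A = "cube_vertex ` slice {} UNIV r :: (real ^ 'n) set"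
  have hyp: "hypersimplex r = convex hull ?A"
    by (simp add: hypersimplex_def layer_eq_cube_vertex_slice)
  have A: "?A \<subseteq> zero_one_points" by (auto simp: zero_one_points_def)
  have finA: "finite ?A" by simp
  obtain i j where ij: "X - Y = {i}" "Y - X = {j}" using adj by (auto simp: swap_adjacent_def)
  define F where "F = convex hull ?A \<inter> {x. (\<forall>k\<in>X \<inter> Y. x $ k = 1) \<and> (\<forall>k\<in>- (X \<union> Y). x $ k = 0)}"
  have face: "F face_of convex hull ?A"
  proof -
    have self: "convex hull ?A face_of convex hull ?A" by (simp add: face_of_refl)
    have "F = \<Inter>({convex hull ?A} \<union> (\<lambda>k. convex hull ?A \<inter> {x. x $ k = 1}) ` (X \<inter> Y)
                  \<union> (\<lambda>k. convex hull ?A \<inter> {x. x $ k = 0}) ` (- (X \<union> Y)))"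
      by (auto simp: F_def)
    also have "\<dots> face_of convex hull ?A"
      using self coordinate_faces[OF A self] by (intro face_of_Inter) auto
    finally show ?thesis .
  qed
  obtain S' where S': "S' \<subseteq> ?A" "F = convex hull S'"
    using face_of_convex_hull_subset[OF finite_imp_compact[OF finA] face] .
  have "S' \<subseteq> {cube_vertex X, cube_vertex Y}"
  proof
    fix x assume x: "x \<in> S'"
    then obtain Z where Z: "x = cube_vertex Z" "card Z = r" using S' by (auto simp: slice_def)
    have "x \<in> F" using x S' hull_inc by metis
    then have fixed: "\<forall>k\<in>X \<inter> Y. x $ k = 1" "\<forall>k\<in>- (X \<union> Y). x $ k = 0"
      by (simp_all add: F_def)
    have "X \<inter> Y \<subseteq> Z"
      using fixed(1) Z(1) by (metis cube_vertex_nth subsetI zero_neq_one)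
    have "Z \<subseteq> X \<union> Y"
      using fixed(2) Z(1) by (metis ComplI cube_vertex_nth subsetI zero_neq_one)
    have "X \<subseteq> Z \<or> Z \<subseteq> Y"
    proof (cases "i \<in> Z")
      case True
      have "X = insert i (X \<inter> Y)" using ij(1) by blast
      then show ?thesis using True \<open>X \<inter> Y \<subseteq> Z\<close> by (metis insert_subset)
    next
      case False
      have "X \<union> Y = insert i Y" using ij(1) by blast
      then show ?thesis using False \<open>Z \<subseteq> X \<union> Y\<close> by (metis subset_insert)
    qed
    then have "Z = X \<or> Z = Y"
      using X Y Z(2) card_subset_eq[of Z X] card_subset_eq[of Y Z] by (auto simp: slice_def)
    then show "x \<in> {cube_vertex X, cube_vertex Y}" using Z(1) by auto
  qed
  then have "F \<subseteq> convex hull {cube_vertex X, cube_vertex Y}"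
    using S'(2) hull_mono by metis
  moreover have "cube_vertex X \<in> F" "cube_vertex Y \<in> F"
    using X Y by (auto simp: F_def intro!: hull_inc)
  then have "convex hull {cube_vertex X, cube_vertex Y} \<subseteq> F"
    using face_of_imp_convex[OF face] by (intro hull_minimal) auto
  ultimately have F: "F = closed_segment (cube_vertex X) (cube_vertex Y)"
    by (auto simp: segment_convex_hull)
  have "cube_vertex X \<noteq> cube_vertex Y" using ij inj_cube_vertex by (auto dest: injD)
  then have "aff_dim F = 1" using F by (simp add: segment_convex_hull aff_dim_convex_hull aff_dim_2)
  then show ?thesis using face F hyp by (simp add: edge_of_def)
qed

section \<open>Edge expansion of the two classes\<close>

lemma edge_expansion_simple_ge_one:
  fixes P :: "(real ^ 'n) set"
  assumes P: "zero_one_polytope P" "simple_polytope P"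
  shows "1 \<le> edge_expansion (polytope_graph P)"
proof (rule edge_expansion_ge_one[where f = id])
  have "convex P" "P \<noteq> {}" using P(1) by (auto simp: zero_one_polytope_def)
  then show "biregularly_splittable (graph_adjacent P) {v. v extreme_point_of P}"
    using biregularly_splittable_simple_face[OF P] face_of_refl by blast
qed (auto simp: symp_graph_adjacent polytope_graph_def graph_adjacent_def)

lemma edge_expansion_hypersimplex_ge_one:
  assumes "hypersimplex r \<noteq> ({} :: (real ^ 'n) set)"
  shows "1 \<le> edge_expansion (polytope_graph (hypersimplex r :: (real ^ 'n) set))"
proof (rule edge_expansion_ge_one[where f = cube_vertex])
  let ?V = "slice {} UNIV r :: 'n set set"
  have hyp: "hypersimplex r = convex hull (cube_vertex ` ?V)"
    by (simp add: hypersimplex_def layer_eq_cube_vertex_slice)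
  then have "?V \<noteq> {}" using assms by auto
  then show "biregularly_splittable swap_adjacent ?V"
    by (intro biregularly_splittable_slice) auto
  show "symp (swap_adjacent :: 'n set \<Rightarrow> _)" by (rule symp_swap_adjacent)
  show "inj_on cube_vertex ?V" using inj_cube_vertex inj_on_subset by blast
  have "cube_vertex ` ?V \<subseteq> zero_one_points" by (auto simp: zero_one_points_def)
  then have ext: "{v. v extreme_point_of hypersimplex r} = cube_vertex ` ?V"
    using zero_one_point_extreme extreme_points_of_convex_hull unfolding hyp by blast
  then show "fst (polytope_graph (hypersimplex r)) = cube_vertex ` ?V"
    by (simp add: polytope_graph_def)
  fix X Y assume XY: "X \<in> ?V" "Y \<in> ?V" "swap_adjacent X Y"
  then have "X \<noteq> Y" by (auto simp: swap_adjacent_def)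
  then have "cube_vertex X \<noteq> (cube_vertex Y :: real ^ 'n)" using inj_cube_vertex by (auto dest: injD)
  moreover have "cube_vertex X extreme_point_of (hypersimplex r :: (real ^ 'n) set)"
    "cube_vertex Y extreme_point_of (hypersimplex r :: (real ^ 'n) set)"
    using ext XY by blast+
  ultimately show "{cube_vertex X, cube_vertex Y} \<in> snd (polytope_graph (hypersimplex r :: (real ^ 'n) set))"
    using hypersimplex_swap_edge[OF XY] unfolding polytope_graph_def by auto
qed

theorem corollary8:
  fixes P :: "(real ^ 'n) set"
  assumes "zero_one_polytope P"
    and "simple_polytope P \<or> (\<exists>r \<in> {0..CARD('n)}. P = hypersimplex r)"
  shows "edge_expansion (polytope_graph P) \<ge> 1"
proof -
  have "P \<noteq> {}" using assms(1) by (auto simp: zero_one_polytope_def)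
  then show ?thesis
    using assms edge_expansion_simple_ge_one edge_expansion_hypersimplex_ge_one by blast
qed

end
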